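(* For every real number $k_0$ there is a number $L_{k_0}>0$, depending only on $k_0$, such that the following holds. Let $k_1\ge k_0$ be a constant with $k_1\le (\pi/(2L_{k_0}))^2$ (which is automatic if $k_1\le 0$). If $\mathcal{C}\subset\mathbb{R}^2$ is a convex curve whose affine curvature satisfies $k_0\le\kappa\le k_1$ and $m=\lfloor \Lambda(\mathcal{C})/(2L_{k_0})\rfloor$, then $$\#(\mathbb{Z}^2\cap\mathcal{C})\le 2m+2.$$
   Context: For $v=(v_1,v_2),w=(w_1,w_2)\in\mathbb{R}^2$ put $v\wedge w=v_1w_2-v_2w_1$. A $C^3$ curve $c\colon I\to\mathbb{R}^2$ on an interval has affine unit speed if $c'\wedge c''\equiv1$; its affine curvature is the continuous function $\kappa$ with $c'''=-\kappa c'$. A convex curve $\mathcal{C}$ is an embedded connected curve contained in the boundary of its convex hull; curves are assumed to admit a $C^3$ affine unit speed parameterization, $\kappa$ is regarded as a function on $\mathcal{C}$, and the affine arc length $\Lambda(\mathcal{C})$ (assumed finite) is the length of the parameter interval of an affine unit speed parameterization traversing $\mathcal{C}$ once. *)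

theory Defs
  imports "HOL-Analysis.Analysis"
begin

definition wedge :: "real^2 \<Rightarrow> real^2 \<Rightarrow> real" where
  "wedge v w = v $ 1 * w $ 2 - v $ 2 * w $ 1"

text \<open>Derivative relative to the parameter interval: one-sided at endpoints belonging to \<open>I\<close>.\<close>

definition deriv_in :: "real set \<Rightarrow> (real \<Rightarrow> real^2) \<Rightarrow> real \<Rightarrow> real^2" where
  "deriv_in I c = (\<lambda>t. vector_derivative c (at t within I))"

definition C3_on :: "real set \<Rightarrow> (real \<Rightarrow> real^2) \<Rightarrow> bool" where
  "C3_on I c \<longleftrightarrow>
     c differentiable_on I \<and>
     deriv_in I c differentiable_on I \<and>
     deriv_in I (deriv_in I c) differentiable_on I \<and>
     continuous_on I (deriv_in I (deriv_in I (deriv_in I c)))"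

definition affine_unit_speed :: "real set \<Rightarrow> (real \<Rightarrow> real^2) \<Rightarrow> bool" where
  "affine_unit_speed I c \<longleftrightarrow>
     (\<forall>t\<in>I. wedge (deriv_in I c t) (deriv_in I (deriv_in I c) t) = 1)"

definition has_affine_curvature ::
    "real set \<Rightarrow> (real \<Rightarrow> real^2) \<Rightarrow> (real \<Rightarrow> real) \<Rightarrow> bool" where
  "has_affine_curvature I c k \<longleftrightarrow>
     continuous_on I k \<and>
     (\<forall>t\<in>I. deriv_in I (deriv_in I (deriv_in I c)) t = - k t *\<^sub>R deriv_in I c t)"

text \<open>\<open>c\<close> traverses the embedded curve \<open>C\<close> exactly once. Either \<open>C\<close> is an arc (with or
  without its endpoints) and \<open>c\<close> is a topological embedding, or \<open>C\<close> is a closed curve and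
  \<open>c\<close> runs around it once, the only coincidence being that of the two endpoints.\<close>

definition traverses_once :: "real set \<Rightarrow> (real \<Rightarrow> real^2) \<Rightarrow> (real^2) set \<Rightarrow> bool" where
  "traverses_once I c C \<longleftrightarrow>
     (\<exists>g. homeomorphism I C c g) \<or>
     (\<exists>a b. a < b \<and> I = {a..b} \<and> continuous_on {a..b} c \<and> c ` {a..b} = C \<and>
            inj_on c {a..<b} \<and> c a = c b)"

text \<open>Boundedness of \<open>I\<close> expresses that the affine arc length of \<open>C\<close>, which is the length
  of \<open>I\<close>, is finite.\<close>

definition affine_parametrization ::
    "real set \<Rightarrow> (real \<Rightarrow> real^2) \<Rightarrow> (real^2) set \<Rightarrow> bool" where
  "affine_parametrization I c C \<longleftrightarrow>
     is_interval I \<and> interior I \<noteq> {} \<and> bounded I \<and>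
     C3_on I c \<and> affine_unit_speed I c \<and> traverses_once I c C"

definition convex_curve :: "(real^2) set \<Rightarrow> bool" where
  "convex_curve C \<longleftrightarrow>
     (\<exists>I c. affine_parametrization I c C) \<and> C \<subseteq> frontier (convex hull C)"

definition integer_lattice :: "(real^2) set" where
  "integer_lattice = {p. \<forall>i. p $ i \<in> \<int>}"

end

theory Submission
  imports Defs
begin

text \<open>
  Affine arcs that are short compared with the curvature bounds contain at most two lattice
  points. Three consecutive points \<open>c x\<close>, \<open>c y\<close>, \<open>c z\<close> of the curve span a triangle of twice the
  (signed) area \<open>A = (c y - c x) \<and> (c z - c y)\<close>, which is an integer if the points are lattice
  points. Applying the mean value theorem in each factor gives
  \<open>A = (y - x) (z - y) (c' \<xi> \<and> c' \<eta>)\<close> for some \<open>x < \<xi> < y < \<eta> < z\<close>.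

  For fixed \<open>\<xi>\<close> the function \<open>u t = c' \<xi> \<and> c' t\<close> solves the scalar equation \<open>u'' = - \<kappa> u\<close> with
  \<open>u \<xi> = 0\<close> and \<open>u' \<xi> = 1\<close>, because \<open>c''' = - \<kappa> c'\<close> and \<open>c' \<and> c'' = 1\<close>. The upper bound
  \<open>\<kappa> \<le> (\<pi> / (2 L))\<^sup>2\<close> makes \<open>u\<close> positive on an interval of length \<open>2 L\<close> by Sturm comparison with a
  sine (\<open>sturm_positive\<close>). The lower bound \<open>\<kappa> \<ge> k0\<close> limits the growth of \<open>u\<close>
  (\<open>jacobi_upper_bound\<close>), so that \<open>0 < A < 1\<close> when \<open>z - x < 2 L\<close> and \<open>L\<close> is small in terms of \<open>k0\<close>
  (\<open>wedge_short_arc\<close>); the choice \<open>L = 1 / (4 (\<bar>k0\<bar> + 1))\<close> suffices. No integer lies strictly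
  between 0 and 1, so a half-open parameter interval of length \<open>2 L\<close> contains at most two parameters
  of lattice points, and \<open>m + 1\<close> such intervals cover the domain of the curve
  (\<open>card_le_of_sparse_triples\<close>).
\<close>

section \<open>Comparison for the scalar equation\<close>

text \<open>Sturm comparison: as long as \<open>u\<close> is positive, the Wronskian of \<open>u\<close> with
  \<open>v x = sin (\<omega> (x - s))\<close> increases from 0, so \<open>u / v\<close> is nondecreasing and \<open>u\<close> cannot reach zero
  before \<open>v\<close> does.\<close>

lemma sturm_positive:
  fixes u du q :: "real \<Rightarrow> real"
  assumes st: "s < t" and \<omega>: "0 < \<omega>" and len: "\<omega> * (t - s) < pi"
    and u: "\<And>x. x \<in> {s..t} \<Longrightarrow> (u has_real_derivative du x) (at x)"
    and du: "\<And>x. x \<in> {s..t} \<Longrightarrow> (du has_real_derivative - q x * u x) (at x)"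
    and q: "\<And>x. x \<in> {s..t} \<Longrightarrow> q x \<le> \<omega>\<^sup>2"
    and init: "u s = 0" "0 < du s"
  shows "0 < u t"
proof (rule ccontr)
  assume "\<not> 0 < u t"
  then have ut: "u t \<le> 0" by simp
  obtain \<delta> where \<delta>: "\<delta> > 0" "\<And>h. 0 < h \<Longrightarrow> h < \<delta> \<Longrightarrow> u s < u (s + h)"
    using DERIV_pos_inc_right[OF u init(2)] st by auto
  have pos_near: "0 < u x" if "s < x" "x < s + \<delta>" for x
    using \<delta>(2)[of "x - s"] that init by simp
  have st': "s + \<delta> \<le> t" using pos_near[of t] st ut by force
  \<comment> \<open>Since \<open>s\<close> itself is a zero of \<open>u\<close>, the first later one is found by staying away from \<open>s\<close>.\<close>
  define Z where "Z = {x \<in> {s + \<delta> / 2..t}. u x \<le> 0}"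
  have "continuous_on {s + \<delta> / 2..t} u"
    using \<delta>(1) by (intro DERIV_continuous_on[OF has_field_derivative_at_within[OF u]]) auto
  then have "closed Z" unfolding Z_def by (intro continuous_on_closed_Collect_le) auto
  moreover have bdd: "bdd_below Z" unfolding Z_def by (rule bdd_belowI[of _ s]) (use \<delta> in auto)
  moreover have "t \<in> Z" using st' \<delta> ut by (auto simp: Z_def)
  ultimately have InfZ: "Inf Z \<in> Z" using closed_contains_Inf by blast
  define r where "r = Inf Z"
  have r: "s < r" "r \<le> t" "u r \<le> 0" using InfZ \<delta> by (auto simp: r_def Z_def)
  have upos: "0 < u x" if "s < x" "x < r" for x
  proof (cases "x < s + \<delta>")
    case True then show ?thesis using pos_near that by simp
  next
    case False
    show ?thesis
    proof (rule ccontr)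
      assume "\<not> 0 < u x"
      then have "x \<in> Z" using False that r \<delta> by (auto simp: Z_def)
      then show False using cInf_lower[OF _ bdd, of x] that by (simp add: r_def)
    qed
  qed
  define v where "v x = sin (\<omega> * (x - s))" for x
  define W where "W x = du x * v x - u x * (\<omega> * cos (\<omega> * (x - s)))" for x
  have vpos: "0 < v x" if "s < x" "x \<le> t" for x
  proof -
    have "\<omega> * (x - s) \<le> \<omega> * (t - s)" using that \<omega> by (intro mult_left_mono) auto
    then have "\<omega> * (x - s) < pi" using len by linarith
    then show ?thesis unfolding v_def using that \<omega> by (intro sin_gt_zero) simp_all
  qed
  have dv: "(v has_real_derivative \<omega> * cos (\<omega> * (x - s))) (at x)" for x
    unfolding v_def by (auto intro!: derivative_eq_intros)
  have dW: "(W has_real_derivative (\<omega>\<^sup>2 - q x) * u x * v x) (at x)" if "x \<in> {s..t}" for x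
    unfolding W_def using that
    by (auto intro!: derivative_eq_intros u du dv simp: v_def power2_eq_square algebra_simps)
  have Wnonneg: "0 \<le> W x" if x: "s < x" "x < r" for x
  proof -
    have "W s \<le> W x"
    proof (rule DERIV_nonneg_imp_nondecreasing[where f = W])
      fix y assume y: "s \<le> y" "y \<le> x"
      have "0 \<le> (\<omega>\<^sup>2 - q y) * u y * v y"
      proof (cases "y = s")
        case False
        then show ?thesis using y x r upos[of y] vpos[of y] q[of y]
          by (intro mult_nonneg_nonneg) auto
      qed (simp add: init)
      then show "\<exists>d. DERIV W y :> d \<and> 0 \<le> d" using dW[of y] x r y by auto
    qed (use x in simp)
    then show ?thesis by (simp add: W_def v_def init)
  qed
  define p where "p = (s + r) / 2"
  have p: "s < p" "p < r" using r by (auto simp: p_def)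
  have "u p / v p \<le> u r / v r"
  proof (rule DERIV_nonneg_imp_increasing_open[where f = "\<lambda>x. u x / v x"])
    show "p \<le> r" using p by simp
    have cu: "continuous_on {p..r} u"
      using p r by (intro DERIV_continuous_on[OF has_field_derivative_at_within[OF u]]) auto
    have "v x \<noteq> 0" if "x \<in> {p..r}" for x using vpos[of x] that p r by auto
    then show "continuous_on {p..r} (\<lambda>x. u x / v x)"
      using cu by (intro continuous_on_divide DERIV_continuous_on[OF has_field_derivative_at_within[OF dv]]) auto
  next
    fix x assume x: "p < x" "x < r"
    have "((\<lambda>x. u x / v x) has_real_derivative W x / (v x * v x)) (at x)"
      using x p r vpos[of x] unfolding W_def
      by (auto intro!: derivative_eq_intros u dv)
    moreover have "0 \<le> W x / (v x * v x)" using Wnonneg[of x] x p by auto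
    ultimately show "\<exists>y. ((\<lambda>x. u x / v x) has_real_derivative y) (at x) \<and> 0 \<le> y" by blast
  qed
  moreover have "0 < u p / v p" using upos[OF p] vpos[of p] p r by simp
  moreover have "u r / v r \<le> 0" using r vpos[of r] by (simp add: divide_nonpos_pos)
  ultimately show False by simp
qed

text \<open>Factorizing \<open>D\<^sup>2 - b\<^sup>2 = (D + b) (D - b)\<close> turns the second-order inequality \<open>u'' \<le> b\<^sup>2 u\<close> into two
  first-order ones, each integrated with an exponential factor.\<close>

lemma jacobi_upper_bound:
  fixes u du q :: "real \<Rightarrow> real"
  assumes st: "s \<le> t" and b: "0 \<le> b"
    and u: "\<And>x. x \<in> {s..t} \<Longrightarrow> (u has_real_derivative du x) (at x)"
    and du: "\<And>x. x \<in> {s..t} \<Longrightarrow> (du has_real_derivative - q x * u x) (at x)"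
    and q: "\<And>x. x \<in> {s..t} \<Longrightarrow> - b\<^sup>2 \<le> q x"
    and nonneg: "\<And>x. x \<in> {s..t} \<Longrightarrow> 0 \<le> u x"
    and init: "u s = 0" "du s = 1"
  shows "u t \<le> (t - s) * exp (b * (t - s))"
proof -
  define F where "F x = exp (b * (x - s)) * (du x - b * u x)" for x
  have F: "F x \<le> 1" if x: "x \<in> {s..t}" for x
  proof -
    have "F x \<le> F s"
    proof (rule DERIV_nonpos_imp_nonincreasing[where f = F])
      fix y assume y: "s \<le> y" "y \<le> x"
      have "(F has_real_derivative exp (b * (y - s)) * (- ((q y + b\<^sup>2) * u y))) (at y)"
        unfolding F_def using x y
        by (auto intro!: derivative_eq_intros u du simp: power2_eq_square algebra_simps)
      moreover have "exp (b * (y - s)) * (- ((q y + b\<^sup>2) * u y)) \<le> 0"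
        using q[of y] nonneg[of y] x y by (intro mult_nonneg_nonpos) auto
      ultimately show "\<exists>d. DERIV F y :> d \<and> d \<le> 0" by blast
    qed (use x in simp)
    then show ?thesis by (simp add: F_def init)
  qed
  define G where "G x = u x * exp (- (b * (x - s))) - x" for x
  have "G t \<le> G s"
  proof (rule DERIV_nonpos_imp_nonincreasing[where f = G])
    fix y assume y: "s \<le> y" "y \<le> t"
    let ?e = "exp (- (b * (y - s)))"
    have "(G has_real_derivative (du y - b * u y) * ?e - 1) (at y)"
      unfolding G_def using y
      by (auto intro!: derivative_eq_intros u simp: algebra_simps)
    moreover have "(du y - b * u y) * ?e - 1 \<le> 0"
    proof -
      have e: "?e \<le> 1" "0 \<le> ?e" using b y by auto
      have "exp (b * (y - s)) * ?e = 1" by (simp add: exp_minus)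
      then have "(du y - b * u y) * ?e = (exp (b * (y - s)) * ?e) * ((du y - b * u y) * ?e)"
        by simp
      also have "\<dots> = F y * (?e * ?e)" unfolding F_def by (simp only: ac_simps)
      also have "\<dots> \<le> 1 * (?e * ?e)" using F[of y] y by (intro mult_right_mono) auto
      also have "\<dots> \<le> 1" using mult_le_one[OF e(1) e(2) e(1)] by simp
      finally show ?thesis by simp
    qed
    ultimately show "\<exists>d. DERIV G y :> d \<and> d \<le> 0" by blast
  qed (rule st)
  then have "u t / exp (b * (t - s)) \<le> t - s"
    by (simp add: G_def init exp_minus divide_inverse)
  then show ?thesis by (subst (asm) pos_divide_le_eq) simp_all
qed

section \<open>The wedge product\<close>

lemma bounded_bilinear_wedge: "bounded_bilinear wedge"
  unfolding bilinear_conv_bounded_bilinear[symmetric]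
  by (auto simp: bilinear_def wedge_def algebra_simps intro!: linearI)

lemma wedge_self [simp]: "wedge v v = 0"
  by (simp add: wedge_def)

lemma wedge_scaleR_right: "wedge v (r *\<^sub>R w) = r * wedge v w"
  by (simp add: wedge_def algebra_simps)

lemma has_derivative_wedge_right:
  "(f has_vector_derivative f') (at t) \<Longrightarrow>
   ((\<lambda>x. wedge v (f x)) has_real_derivative wedge v f') (at t)"
  using bounded_linear.has_vector_derivative[OF bounded_bilinear.bounded_linear_right[OF bounded_bilinear_wedge]]
  by (simp add: has_real_derivative_iff_has_vector_derivative)

lemma has_derivative_wedge_left:
  "(f has_vector_derivative f') (at t) \<Longrightarrow>
   ((\<lambda>x. wedge (f x) v) has_real_derivative wedge f' v) (at t)"
  using bounded_linear.has_vector_derivative[OF bounded_bilinear.bounded_linear_left[OF bounded_bilinear_wedge]]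
  by (simp add: has_real_derivative_iff_has_vector_derivative)

lemma wedge_lattice_diff_in_Ints:
  assumes "p \<in> integer_lattice" "q \<in> integer_lattice" "r \<in> integer_lattice"
  shows "wedge (q - p) (r - q) \<in> \<int>"
  using assms by (auto simp: wedge_def integer_lattice_def intro!: Ints_diff Ints_mult)

section \<open>Short arcs\<close>

text \<open>Although \<open>x\<close> and \<open>z\<close> may be endpoints of the parameter interval, where derivatives are
  one-sided, the intermediate points produced by the mean value theorem are interior. Derivatives
  are therefore only required on the open interval.\<close>

lemma wedge_mean_value:
  assumes xyz: "x < y" "y < z"
    and cont: "continuous_on {x..z} c"
    and c: "\<And>t. t \<in> {x<..<z} \<Longrightarrow> (c has_vector_derivative c1 t) (at t)"
  obtains \<xi> \<eta> where "x < \<xi>" "\<xi> < y" "y < \<eta>" "\<eta> < z"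
    "wedge (c y - c x) (c z - c y) = (y - x) * (z - y) * wedge (c1 \<xi>) (c1 \<eta>)"
proof -
  interpret w: bounded_bilinear wedge by (rule bounded_bilinear_wedge)
  have contl: "continuous_on {x..y} (\<lambda>t. wedge (c t) v)" for v
    by (intro w.continuous_on continuous_on_subset[OF cont] continuous_on_const) (use xyz in auto)
  have contr: "continuous_on {y..z} (\<lambda>t. wedge v (c t))" for v
    by (intro w.continuous_on continuous_on_subset[OF cont] continuous_on_const) (use xyz in auto)
  obtain \<xi> where \<xi>: "x < \<xi>" "\<xi> < y"
    "wedge (c y) (c z - c y) - wedge (c x) (c z - c y) = (y - x) * wedge (c1 \<xi>) (c z - c y)"
  proof -
    have "\<exists>l \<xi>. x < \<xi> \<and> \<xi> < y \<and> DERIV (\<lambda>t. wedge (c t) (c z - c y)) \<xi> :> l \<and>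
        wedge (c y) (c z - c y) - wedge (c x) (c z - c y) = (y - x) * l"
    proof (intro MVT contl)
      show "(\<lambda>t. wedge (c t) (c z - c y)) differentiable at t" if "x < t" "t < y" for t
        using has_derivative_wedge_left[OF c, of t] that xyz by (auto simp: real_differentiable_def)
    qed (use xyz in simp)
    then show ?thesis
      using that xyz DERIV_unique[OF has_derivative_wedge_left[OF c]] by force
  qed
  have "\<exists>l \<eta>. y < \<eta> \<and> \<eta> < z \<and> DERIV (\<lambda>t. wedge (c1 \<xi>) (c t)) \<eta> :> l \<and>
      wedge (c1 \<xi>) (c z) - wedge (c1 \<xi>) (c y) = (z - y) * l"
  proof (intro MVT contr)
    show "(\<lambda>t. wedge (c1 \<xi>) (c t)) differentiable at t" if "y < t" "t < z" for t
      using has_derivative_wedge_right[OF c, of t] that xyz by (auto simp: real_differentiable_def)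
  qed (use xyz in simp)
  then obtain \<eta> where \<eta>: "y < \<eta>" "\<eta> < z"
    "wedge (c1 \<xi>) (c z) - wedge (c1 \<xi>) (c y) = (z - y) * wedge (c1 \<xi>) (c1 \<eta>)"
    using xyz DERIV_unique[OF has_derivative_wedge_right[OF c]] by force
  have "wedge (c y - c x) (c z - c y) = (y - x) * (z - y) * wedge (c1 \<xi>) (c1 \<eta>)"
    using \<xi>(3) \<eta>(3) by (simp add: w.diff_left w.diff_right)
  then show thesis using that \<xi> \<eta> by blast
qed

text \<open>The constant 4 ensures that \<open>b (t - s) < 1/2\<close> on the arc, so that \<open>c' s \<and> c' t\<close> stays below
  \<open>2 (t - s) < 1\<close>, and that \<open>(y - x) (z - y)\<close> is less than 1.\<close>

lemma wedge_short_arc: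
  fixes c c1 c2 :: "real \<Rightarrow> real^2" and k :: "real \<Rightarrow> real"
  assumes xyz: "x < y" "y < z" and short: "z - x < 2 * L"
    and b: "1 \<le> b" and L: "L = 1 / (4 * b)"
    and cont: "continuous_on {x..z} c"
    and c: "\<And>t. t \<in> {x<..<z} \<Longrightarrow> (c has_vector_derivative c1 t) (at t)"
    and c1: "\<And>t. t \<in> {x<..<z} \<Longrightarrow> (c1 has_vector_derivative c2 t) (at t)"
    and c2: "\<And>t. t \<in> {x<..<z} \<Longrightarrow> (c2 has_vector_derivative - k t *\<^sub>R c1 t) (at t)"
    and unit: "\<And>t. t \<in> {x<..<z} \<Longrightarrow> wedge (c1 t) (c2 t) = 1"
    and k: "\<And>t. t \<in> {x<..<z} \<Longrightarrow> - b\<^sup>2 \<le> k t \<and> k t \<le> (pi / (2 * L))\<^sup>2"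
  shows "0 < wedge (c y - c x) (c z - c y)" "wedge (c y - c x) (c z - c y) < 1"
proof -
  obtain \<xi> \<eta> where \<xi>\<eta>: "x < \<xi>" "\<xi> < y" "y < \<eta>" "\<eta> < z"
    and area: "wedge (c y - c x) (c z - c y) = (y - x) * (z - y) * wedge (c1 \<xi>) (c1 \<eta>)"
    using wedge_mean_value[OF xyz cont c] by metis
  define u where "u t = wedge (c1 \<xi>) (c1 t)" for t
  define du where "du t = wedge (c1 \<xi>) (c2 t)" for t
  have Lpos: "0 < L" and L2: "2 * L \<le> 1 / 2" and bL: "b * (2 * L) = 1 / 2"
    using b by (auto simp: L field_simps)
  have sub: "t \<in> {x<..<z}" if "t \<in> {\<xi>..\<eta>}" for t
    using that \<xi>\<eta> by auto
  have u: "(u has_real_derivative du t) (at t)" if "t \<in> {\<xi>..\<eta>}" for t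
    unfolding u_def du_def by (rule has_derivative_wedge_right[OF c1[OF sub[OF that]]])
  have du: "(du has_real_derivative - k t * u t) (at t)" if "t \<in> {\<xi>..\<eta>}" for t
    using has_derivative_wedge_right[OF c2[OF sub[OF that]], of "c1 \<xi>"]
    by (simp only: u_def du_def[abs_def] wedge_scaleR_right)
  have init: "u \<xi> = 0" "du \<xi> = 1"
    using unit[of \<xi>] \<xi>\<eta> by (auto simp: u_def du_def)
  have pos: "0 < u t" if t: "\<xi> < t" "t \<le> \<eta>" for t
  proof (rule sturm_positive[where u = u and s = \<xi> and du = du and q = k and \<omega> = "pi / (2 * L)"])
    have "pi / (2 * L) * (t - \<xi>) < pi / (2 * L) * (2 * L)"
      using t \<xi>\<eta> short Lpos by (intro mult_strict_left_mono) auto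
    then show "pi / (2 * L) * (t - \<xi>) < pi" using Lpos by simp
  qed (use t Lpos init u du k sub in auto)
  have "u \<eta> \<le> (\<eta> - \<xi>) * exp (b * (\<eta> - \<xi>))"
  proof (rule jacobi_upper_bound[where u = u and du = du and q = k])
    show "0 \<le> u t" if "t \<in> {\<xi>..\<eta>}" for t
      using pos[of t] init(1) that by (cases "t = \<xi>") auto
  qed (use \<xi>\<eta> b init u du k sub in auto)
  also have "\<dots> \<le> (1 / 2) * 2"
  proof (rule mult_mono)
    show "\<eta> - \<xi> \<le> 1 / 2" using \<xi>\<eta> short L2 by simp
    have "b * (\<eta> - \<xi>) \<le> b * (2 * L)" using \<xi>\<eta> short b by (intro mult_left_mono) auto
    then have "exp (b * (\<eta> - \<xi>)) \<le> exp (1 / 2)" using bL by simp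
    also have "\<dots> \<le> 2" using exp_bound_half[of "1 / 2 :: real"] by simp
    finally show "exp (b * (\<eta> - \<xi>)) \<le> 2" .
  qed (use \<xi>\<eta> in auto)
  finally have u1: "u \<eta> \<le> 1" by simp
  have u0: "0 < u \<eta>" using pos \<xi>\<eta> by simp
  show "0 < wedge (c y - c x) (c z - c y)" using area u0 xyz by (simp add: u_def)
  have "(y - x) * (z - y) < 1 * 1"
    using xyz short L2 by (intro mult_strict_mono) auto
  moreover have "(y - x) * (z - y) * u \<eta> \<le> (y - x) * (z - y)"
    using u1 xyz by (intro mult_left_le) auto
  ultimately have "(y - x) * (z - y) * u \<eta> < 1" by simp
  then show "wedge (c y - c x) (c z - c y) < 1" using area by (simp add: u_def)
qed

section \<open>Counting\<close>

lemma card_le_2_if_no_increasing_triple: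
  fixes T :: "'a::linorder set"
  assumes "\<And>x y z. x \<in> T \<Longrightarrow> y \<in> T \<Longrightarrow> z \<in> T \<Longrightarrow> x < y \<Longrightarrow> y < z \<Longrightarrow> False"
  shows "finite T \<and> card T \<le> 2"
proof (rule ccontr)
  assume "\<not> ?thesis"
  then have "infinite T \<or> 3 \<le> card T" by auto
  then obtain S where S: "S \<subseteq> T" "card S = 3"
    by (metis infinite_arbitrarily_large obtain_subset_with_card_n)
  then obtain p q r where "S = {p, q, r}" "p \<noteq> q" "q \<noteq> r" "p \<noteq> r"
    by (auto simp: card_3_iff)
  then have "p \<in> T" "q \<in> T" "r \<in> T" and "p \<noteq> q" "q \<noteq> r" "p \<noteq> r" using S by auto
  then show False using assms by (metis linorder_neqE)
qed

text \<open>The half-open intervals \<open>{a + j d..<a + (j + 1) d}\<close> with \<open>j = 0, \<dots>, \<lfloor>(e - a) / d\<rfloor>\<close> cover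
  \<open>{a..e}\<close>, and each contains at most two points of the set.\<close>

lemma card_le_of_sparse_triples:
  fixes T :: "real set"
  assumes T: "T \<subseteq> {a..e}" and d: "0 < d" and ae: "a \<le> e"
    and sparse: "\<And>x y z. x \<in> T \<Longrightarrow> y \<in> T \<Longrightarrow> z \<in> T \<Longrightarrow> x < y \<Longrightarrow> y < z \<Longrightarrow> d \<le> z - x"
  shows "finite T \<and> int (card T) \<le> 2 * \<lfloor>(e - a) / d\<rfloor> + 2"
proof -
  define m where "m = \<lfloor>(e - a) / d\<rfloor>"
  define P where "P j = {t \<in> T. \<lfloor>(t - a) / d\<rfloor> = j}" for j
  have m: "0 \<le> m" using ae d by (simp add: m_def)
  have cover: "T = (\<Union>j\<in>{0..m}. P j)"
  proof -
    have "\<lfloor>(t - a) / d\<rfloor> \<in> {0..m}" if "t \<in> T" for t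
      unfolding m_def using that T d by (auto intro!: floor_mono divide_right_mono)
    then show ?thesis by (auto simp: P_def)
  qed
  have P: "finite (P j) \<and> card (P j) \<le> 2" for j
  proof (rule card_le_2_if_no_increasing_triple)
    fix x y z assume "x \<in> P j" "y \<in> P j" "z \<in> P j" "x < y" "y < z"
    then have "d \<le> z - x" and fl: "\<lfloor>(x - a) / d\<rfloor> = j" "\<lfloor>(z - a) / d\<rfloor> = j"
      using sparse by (auto simp: P_def)
    then have "1 \<le> ((z - a) - (x - a)) / d" using d by simp
    then have "(x - a) / d + 1 \<le> (z - a) / d" by (simp add: diff_divide_distrib)
    then show False using fl by linarith
  qed
  have "finite T" by (subst cover) (use P in auto)
  moreover have "card T \<le> (\<Sum>j\<in>{0..m}. card (P j))"
    by (subst cover) (rule card_UN_le, simp)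
  moreover have "\<dots> \<le> card {0..m} * 2"
    using sum_bounded_above[of "{0..m}" "\<lambda>j. card (P j)" 2] P by simp
  ultimately show ?thesis using m unfolding m_def[symmetric] by simp
qed

section \<open>The parameter interval\<close>

lemma bounded_interval_within_length:
  fixes I :: "real set"
  assumes "is_interval I" "interior I \<noteq> {}" "bounded I"
  obtains a e where "a < e" "I \<subseteq> {a..e}" "{a<..<e} \<subseteq> I" "e - a = measure lborel I"
proof -
  define a where "a = Inf I"
  define e where "e = Sup I"
  have ne: "I \<noteq> {}" using assms(2) by auto
  have bdd: "bdd_above I" "bdd_below I"
    using assms(3) by (auto intro: bounded_imp_bdd_above bounded_imp_bdd_below)
  have sub: "I \<subseteq> {a..e}" using bdd by (auto simp: a_def e_def cInf_lower cSup_upper)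
  have sup: "{a<..<e} \<subseteq> I"
  proof
    fix t assume t: "t \<in> {a<..<e}"
    obtain p where "p \<in> I" "p < t" using t cInf_less_iff[OF ne bdd(2)] by (auto simp: a_def)
    moreover obtain q where "q \<in> I" "t < q" using t less_cSup_iff[OF ne bdd(1)] by (auto simp: e_def)
    ultimately show "t \<in> I" using assms(1) unfolding is_interval_1 by (meson less_imp_le)
  qed
  have "interior I \<subseteq> {a<..<e}" using interior_mono[OF sub] by simp
  then have ae: "a < e" using assms(2) by auto
  have I: "I = {a<..<e} \<union> (I \<inter> {a, e})" using sub sup ae by force
  have "I \<in> sets lborel" 
  proof (subst I, rule sets.Un)
    show "I \<inter> {a, e} \<in> sets lborel" by (simp add: borel_closed finite_imp_closed)
  qed simp
  moreover have "emeasure lborel I = ennreal (e - a)"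
  proof (rule antisym)
    show "emeasure lborel I \<le> ennreal (e - a)" using emeasure_mono[OF sub, of lborel] ae by simp
    show "ennreal (e - a) \<le> emeasure lborel I"
      using emeasure_mono[OF sup \<open>I \<in> sets lborel\<close>] ae by simp
  qed
  ultimately have "measure lborel I = e - a" using ae by (simp add: measure_def)
  then show thesis using that ae sub sup by simp
qed

lemma deriv_in_has_vector_derivative:
  assumes "f differentiable_on I" "{a<..<e} \<subseteq> I" "t \<in> {a<..<e}"
  shows "(f has_vector_derivative deriv_in I f t) (at t)"
proof -
  have "(f has_vector_derivative deriv_in I f t) (at t within I)"
    using assms by (auto simp: deriv_in_def differentiable_on_def vector_derivative_works[symmetric])
  then show ?thesis
    using assms(2,3) has_vector_derivative_within_subset has_vector_derivative_within_open
    by (metis open_greaterThanLessThan)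
qed

theorem theorem2:
  "\<forall>k0::real. \<exists>L::real. L > 0 \<and>
     (\<forall>k1::real. k0 \<le> k1 \<and> k1 \<le> (pi / (2 * L))\<^sup>2 \<longrightarrow>
       (\<forall>(C :: (real^2) set) (I :: real set) (c :: real \<Rightarrow> real^2) (\<kappa> :: real^2 \<Rightarrow> real) (m :: int).
          convex_curve C \<and> affine_parametrization I c C \<and>
          has_affine_curvature I c (\<kappa> \<circ> c) \<and>
          (\<forall>p\<in>C. k0 \<le> \<kappa> p \<and> \<kappa> p \<le> k1) \<and>
          m = \<lfloor>measure lborel I / (2 * L)\<rfloor> \<longrightarrow>
          finite (integer_lattice \<inter> C) \<and>
          int (card (integer_lattice \<inter> C)) \<le> 2 * m + 2))"
proof
  fix k0 :: real
  \<comment> \<open>The summand 1 gives both \<open>b \<ge> 1\<close> and \<open>b\<^sup>2 \<ge> \<bar>k0\<bar>\<close>, whatever the size of \<open>k0\<close>.\<close>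
  define b where "b = \<bar>k0\<bar> + 1"
  define L where "L = 1 / (4 * b)"
  have b: "1 \<le> b" by (simp add: b_def)
  have Lpos: "L > 0" using b by (simp add: L_def)
  have kb: "- b\<^sup>2 \<le> k0"
  proof -
    have "b * 1 \<le> b * b" using b by (intro mult_left_mono) auto
    then show ?thesis by (simp add: b_def power2_eq_square)
  qed
  have bound: "finite (integer_lattice \<inter> C) \<and>
      int (card (integer_lattice \<inter> C)) \<le> 2 * \<lfloor>measure lborel I / (2 * L)\<rfloor> + 2"
    if k1: "k1 \<le> (pi / (2 * L))\<^sup>2" and par: "affine_parametrization I c C"
      and curv: "has_affine_curvature I c (\<kappa> \<circ> c)"
      and \<kappa>: "\<forall>p\<in>C. k0 \<le> \<kappa> p \<and> \<kappa> p \<le> k1"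
    for k1 C I c \<kappa>
  proof -
    define c1 where "c1 = deriv_in I c"
    define c2 where "c2 = deriv_in I c1"
    have I: "is_interval I" "interior I \<noteq> {}" "bounded I"
      and C3: "c differentiable_on I" "c1 differentiable_on I" "c2 differentiable_on I"
      and unit: "\<And>t. t \<in> I \<Longrightarrow> wedge (c1 t) (c2 t) = 1"
      and tr: "traverses_once I c C"
      using par by (auto simp: affine_parametrization_def C3_on_def affine_unit_speed_def c1_def c2_def)
    have C: "C = c ` I" using tr by (auto simp: traverses_once_def homeomorphism_def)
    have c3: "deriv_in I c2 t = - \<kappa> (c t) *\<^sub>R c1 t" if "t \<in> I" for t
      using curv that by (simp add: has_affine_curvature_def c1_def c2_def)
    obtain a e where ae: "a < e" "I \<subseteq> {a..e}" "{a<..<e} \<subseteq> I" "e - a = measure lborel I"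
      using bounded_interval_within_length[OF I] .
    define T where "T = {t \<in> I. c t \<in> integer_lattice}"
    have T: "integer_lattice \<inter> C = c ` T" by (auto simp: T_def C)
    have "2 * L \<le> z - x" if xyz: "x \<in> T" "y \<in> T" "z \<in> T" "x < y" "y < z" for x y z
    proof (rule ccontr)
      assume "\<not> 2 * L \<le> z - x"
      then have short: "z - x < 2 * L" by simp
      have xz: "{x..z} \<subseteq> I" using xyz I(1) unfolding is_interval_1 T_def by (auto intro: order_trans)
      have xz': "t \<in> {a<..<e}" "t \<in> I" if "t \<in> {x<..<z}" for t
        using xyz that ae(2) xz by (force simp: T_def)+
      have cont: "continuous_on {x..z} c"
        using differentiable_imp_continuous_on[OF C3(1)] continuous_on_subset xz by blast
      have c2: "(c2 has_vector_derivative - (\<kappa> (c t)) *\<^sub>R c1 t) (at t)" if "t \<in> {x<..<z}" for t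
        using deriv_in_has_vector_derivative[OF C3(3) ae(3) xz'(1)[OF that]] c3[OF xz'(2)[OF that]] by simp
      have \<kappa>': "- b\<^sup>2 \<le> \<kappa> (c t) \<and> \<kappa> (c t) \<le> (pi / (2 * L))\<^sup>2" if "t \<in> {x<..<z}" for t
      proof -
        have "k0 \<le> \<kappa> (c t)" "\<kappa> (c t) \<le> k1" using \<kappa> xz'(2)[OF that] C by auto
        then show ?thesis using kb k1 by linarith
      qed
      have "0 < wedge (c y - c x) (c z - c y)" "wedge (c y - c x) (c z - c y) < 1"
        using wedge_short_arc[OF xyz(4,5) short b L_def cont, where ?c1.0 = c1 and ?c2.0 = c2 and k = "\<kappa> \<circ> c"]
          deriv_in_has_vector_derivative[OF C3(1) ae(3) xz'(1)]
          deriv_in_has_vector_derivative[OF C3(2) ae(3) xz'(1)] c2 unit[OF xz'(2)] \<kappa>'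
        by (simp_all add: c1_def c2_def)
      moreover have "wedge (c y - c x) (c z - c y) \<in> \<int>"
        using xyz by (intro wedge_lattice_diff_in_Ints) (auto simp: T_def)
      ultimately show False by (auto elim!: Ints_cases)
    qed
    then have "finite T \<and> int (card T) \<le> 2 * \<lfloor>(e - a) / (2 * L)\<rfloor> + 2"
      using ae Lpos by (intro card_le_of_sparse_triples) (auto simp: T_def)
    then show ?thesis
      using card_image_le[of T c] by (simp add: T ae(4))
  qed
  show "\<exists>L>0. \<forall>k1. k0 \<le> k1 \<and> k1 \<le> (pi / (2 * L))\<^sup>2 \<longrightarrow>
       (\<forall>C I c \<kappa> m.
          convex_curve C \<and> affine_parametrization I c C \<and>
          has_affine_curvature I c (\<kappa> \<circ> c) \<and>
          (\<forall>p\<in>C. k0 \<le> \<kappa> p \<and> \<kappa> p \<le> k1) \<and>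
          m = \<lfloor>measure lborel I / (2 * L)\<rfloor> \<longrightarrow>
          finite (integer_lattice \<inter> C) \<and>
          int (card (integer_lattice \<inter> C)) \<le> 2 * m + 2)"
  proof (intro exI[of _ L] conjI allI impI Lpos)
  qed (use bound in blast)+
qed

end
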